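(* Let $n\ge 1$, $m\ge 0$, and let $\mathbf{t}=(t_1,\dots,t_m)$ be a strictly increasing sequence of elements of $[n]$. Then the number of increasing parking completions of $\mathbf{t}$ in $[n]$ is \[ \big|\mathrm{IPC}_n(\mathbf{t})\big| = \sum_{\boldsymbol\ell\in L_n(\mathbf{t})} \prod_{i=1}^{m+1} \frac{1}{\ell_i+1} \binom{2\ell_i}{\ell_i}, \] where \[ L_n(\mathbf{t})= \Big\{\boldsymbol\ell=(\ell_1,\dots,\ell_{m+1})\in\mathbb{N}^{m+1}\ \Big|\ \ell_1+\cdots+\ell_j \geq t_j-j \text{ for all } j\in[m],\ \text{and } \ell_1+\cdots+\ell_{m+1}=n-m \Big\}. \]
   Context: $\mathbb{N}=\{0,1,2,\dots\}$ and $[n]=\{1,\dots,n\}$. Given $\mathbf{t}$, let $\mathbf{u}=(u_1,\dots,u_{n-m})$ be the elements of $[n]\setminus\{t_1,\dots,t_m\}$ in strictly increasing order. An increasing parking completion of $\mathbf{t}$ in $[n]$ is a weakly increasing sequence $(c_1,\dots,c_{n-m})\in[n]^{n-m}$ with $c_i\le u_i$ for all $i$; $\mathrm{IPC}_n(\mathbf{t})$ denotes the set of them. *)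

theory Defs
  imports Complex_Main
begin

text \<open>
  Finite sequences are lists, so the mathematical index \<open>i\<close> (counted from 1) is the list
  position \<open>i - 1\<close>.
\<close>

definition unoccupied :: "nat \<Rightarrow> nat list \<Rightarrow> nat list" where
  "unoccupied n t = sorted_list_of_set ({1..n} - set t)"

definition IPC :: "nat \<Rightarrow> nat list \<Rightarrow> nat list set" where
  "IPC n t = {c. length c = n - length t \<and> set c \<subseteq> {1..n} \<and> sorted c \<and>
                 (\<forall>i < n - length t. c ! i \<le> unoccupied n t ! i)}"

text \<open>
  \<open>sum_list (take j l)\<close> is the partial sum of the first \<open>j\<close> entries of \<open>l\<close>. The
  differences are taken in the integers to avoid truncated subtraction.
\<close>

definition L :: "nat \<Rightarrow> nat list \<Rightarrow> nat list set" where
  "L n t = {l. length l = length t + 1 \<and>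
               (\<forall>j \<in> {1..length t}. int (sum_list (take j l)) \<ge> int (t ! (j - 1)) - int j) \<and>
               int (sum_list l) = int n - int (length t)}"

end

theory Submission
  imports Defs
begin

text \<open>
  Read a weakly increasing sequence \<open>c\<close> as a lattice path with \<open>n - m\<close> up steps and \<open>n\<close> down
  steps, where the entries equal to \<open>k\<close> are the up steps just before the \<open>k\<close>-th down step. The
  path ends at height \<open>-m\<close>, and \<open>c\<close> is a completion of \<open>t\<close> iff the first passage to height
  \<open>-j\<close> is not earlier than the \<open>t\<^sub>j\<close>-th down step. Cutting the path at its first passages to
  \<open>-1, \<dots>, -m\<close> leaves \<open>m + 1\<close> Dyck paths, of semilengths \<open>\<ell>\<^sub>1, \<dots>, \<ell>\<^sub>m\<^sub>+\<^sub>1\<close>, and the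
  first passage to \<open>-j\<close> is down step number \<open>\<ell>\<^sub>1 + \<dots> + \<ell>\<^sub>j + j\<close>. The
  identity follows because the numbers of paths to a lattice point, counted directly and counted
  by first passages, satisfy the same recurrence.
\<close>

section \<open>Ballot numbers\<close>

definition catalan :: "nat \<Rightarrow> real" where
  "catalan k = 1 / (real k + 1) * real ((2 * k) choose k)"

text \<open>
  Integer arguments and the value 0 outside \<open>0 \<le> y \<le> x\<close> make the recurrence below uniform.
\<close>

definition ballot :: "int \<Rightarrow> int \<Rightarrow> real" where
  "ballot x y = (if 0 \<le> y \<and> y \<le> x
     then real (nat (x + y) choose nat x) - real (nat (x + y) choose nat (x + 1)) else 0)"

lemma ballot_eq_0: "y < 0 \<or> x < y \<Longrightarrow> ballot x y = 0"
  by (auto simp: ballot_def)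

text \<open>The range reaches one step past the diagonal: there the two binomials agree by symmetry,
  matching the default value 0. \<open>ballot_rec\<close> needs this edge case at
  \<open>y = x\<close>.\<close>

lemma ballot_of_nat:
  assumes "b \<le> Suc a"
  shows "ballot (int a) (int b) = real ((a + b) choose a) - real ((a + b) choose Suc a)"
proof (cases "b = Suc a")
  case True
  have "(a + Suc a) choose a = (a + Suc a) choose Suc a"
    by (subst binomial_symmetric) auto
  then show ?thesis using True by (simp add: ballot_def)
next
  case False
  then have "nat (int a + int b) = a + b" "nat (int a + 1) = Suc a" "b \<le> a"
    using assms by auto
  then show ?thesis by (simp add: ballot_def)
qed

lemma ballot_diag: "ballot (int k) (int k) = catalan k"
proof (cases k)
  case (Suc p)
  have "Suc k * (Suc (k + p) choose Suc k) = Suc p * (Suc (k + p) choose k)"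
    by (rule Suc_times_binomial_add)
  then have "Suc k * ((2 * k) choose Suc k) = k * ((2 * k) choose k)"
    using Suc by (simp add: mult_2)
  then have "real (Suc k) * real ((2 * k) choose Suc k) = real k * real ((2 * k) choose k)"
    by (metis of_nat_mult)
  then have "real ((2 * k) choose k) - real ((2 * k) choose Suc k) = catalan k"
    by (simp add: catalan_def field_simps)
  then show ?thesis by (simp add: ballot_of_nat mult_2)
qed (simp add: ballot_def catalan_def)

text \<open>Pascal's rule, read as removing the last step of a path. The added 1 is the empty path;
  the subtracted term cancels the paths that step from height 0 to height -1.\<close>

lemma ballot_rec:
  "ballot x y = ballot (x - 1) y + ballot x (y - 1) + (if x = 0 \<and> y = 0 then 1 else 0)
     - (if 0 \<le> x \<and> y = x + 1 then ballot x x else 0)"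
proof -
  consider "x < 0 \<or> y < 0 \<or> y > x + 1" | "0 \<le> x" "y = x + 1" | "x = 0" "y = 0"
    | "0 < x" "y = 0" | "0 < y" "y \<le> x"
    by linarith
  then show ?thesis
  proof cases
    case 4
    then show ?thesis by (simp add: ballot_def binomial_eq_0)
  next
    case 5
    define a b where "a = nat (x - 1)" and "b = nat (y - 1)"
    have ab: "x = int (Suc a)" "y = int (Suc b)" "x - 1 = int a" "y - 1 = int b" "b \<le> a"
      using 5 by (auto simp: a_def b_def)
    show ?thesis
      using ab(5) unfolding ab(3,4) unfolding ab(1,2) by (subst (1 2 3) ballot_of_nat) auto
  qed (auto simp: ballot_def)
qed

section \<open>First passage decomposition\<close>

primrec passage :: "nat list \<Rightarrow> nat \<Rightarrow> nat \<Rightarrow> real" where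
  "passage t 0 s = (if s = 0 then 1 else 0)"
| "passage t (Suc j) s =
     (if t ! j \<le> s + Suc j then \<Sum>r\<le>s. passage t j r * catalan (s - r) else 0)"

text \<open>
  \<open>passage t j s\<close> counts the admissible paths up to their first passage to \<open>-j\<close> that contain
  \<open>s\<close> up steps. A path to the point with \<open>x\<close> up and \<open>y\<close> down steps is cut at the first
  passage to its minimum \<open>-j\<close>; the bound \<open>N\<close> on \<open>s\<close> is immaterial as soon as \<open>x \<le> N\<close>.
\<close>

definition paths :: "nat list \<Rightarrow> nat \<Rightarrow> int \<Rightarrow> int \<Rightarrow> real" where
  "paths t N x y =
     (\<Sum>j\<le>length t. \<Sum>s\<le>N. passage t j s * ballot (x - int s) (y - int s - int j))"

text \<open>A nonzero value at \<open>s\<close> has a nonzero summand at some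
  \<open>r \<le> s\<close>, and the earlier bounds for \<open>r\<close> imply those for
  \<open>s\<close>.\<close>

lemma passage_nonzero_imp:
  "passage t j s \<noteq> 0 \<Longrightarrow> i < j \<Longrightarrow> t ! i \<le> s + Suc i"
proof (induction j arbitrary: s)
  case (Suc j)
  from Suc.prems have "t ! j \<le> s + Suc j" and nz: "(\<Sum>r\<le>s. passage t j r * catalan (s - r)) \<noteq> 0"
    by (auto split: if_splits)
  obtain r where "r \<le> s" "passage t j r \<noteq> 0"
    using nz by (metis (no_types, lifting) atMost_iff mult_eq_0_iff sum.neutral)
  then show ?case using Suc.IH[of r] Suc.prems(2) \<open>t ! j \<le> s + Suc j\<close>
    by (cases "i = j") fastforce+
qed simp

text \<open>This is \<open>ballot_rec\<close> weighted by \<open>passage\<close> and summed. The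
  added sum holds the paths just arriving at a new minimum \<open>-j\<close>; the subtracted one
  holds those leaving minimum \<open>-j\<close> downwards.\<close>

lemma paths_rec:
  assumes "u \<le> N"
  shows "paths t N (int u) y = paths t N (int u - 1) y + paths t N (int u) (y - 1)
    + (\<Sum>j\<le>length t. if y = int u + int j then passage t j u else 0)
    - (\<Sum>j\<le>length t. if y = int u + int (Suc j)
         then \<Sum>s\<le>u. passage t j s * catalan (u - s) else 0)"
proof -
  have A: "(\<Sum>s\<le>N. passage t j s * (if int u - int s = 0 \<and> y - int s - int j = 0 then 1 else 0))
      = (if y = int u + int j then passage t j u else 0)" (is "?l = ?r") for j
  proof -
    have "?l = (\<Sum>s\<le>N. if s = u then (if y = int u + int j then passage t j u else 0) else 0)"
      by (rule sum.cong) auto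
    also have "\<dots> = ?r" using assms by simp
    finally show ?thesis .
  qed
  have B: "(\<Sum>s\<le>N. passage t j s * (if 0 \<le> int u - int s \<and> y - int s - int j = int u - int s + 1
        then ballot (int u - int s) (int u - int s) else 0))
      = (if y = int u + int (Suc j) then \<Sum>s\<le>u. passage t j s * catalan (u - s) else 0)"
      (is "?l = ?r") for j
  proof -
    have "?l = (\<Sum>s\<in>{..N}. if s \<in> {..u} then
        (if y = int u + int (Suc j) then passage t j s * catalan (u - s) else 0) else 0)"
      by (rule sum.cong) (auto simp: ballot_diag[symmetric] of_nat_diff)
    also have "\<dots> = (\<Sum>s\<in>{..N} \<inter> {..u}.
        (if y = int u + int (Suc j) then passage t j s * catalan (u - s) else 0))"
      by (simp only: sum.inter_restrict finite_atMost)
    also have "{..N} \<inter> {..u} = {..u}" using assms by auto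
    finally show ?thesis by simp
  qed
  have eq: "passage t j s * ballot (int u - int s) (y - int s - int j) =
        passage t j s * ballot (int u - 1 - int s) (y - int s - int j)
      + passage t j s * ballot (int u - int s) (y - 1 - int s - int j)
      + passage t j s * (if int u - int s = 0 \<and> y - int s - int j = 0 then 1 else 0)
      - passage t j s * (if 0 \<le> int u - int s \<and> y - int s - int j = int u - int s + 1
        then ballot (int u - int s) (int u - int s) else 0)" for j s
    using arg_cong[OF ballot_rec[of "int u - int s" "y - int s - int j"],
        of "\<lambda>z. passage t j s * z"]
    by (simp add: algebra_simps)
  show ?thesis
    unfolding paths_def by (subst eq) (simp only: sum.distrib sum_subtractf A B)
qed

lemma paths_eq_0:
  assumes "x < 0 \<or> y < 0 \<or> x + int (length t) < y"
  shows "paths t N x y = 0"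
  unfolding paths_def by (intro sum.neutral ballI) (use assms in \<open>auto intro!: ballot_eq_0\<close>)

section \<open>Admissible lattice points\<close>

text \<open>A sequence lies termwise below the unoccupied places iff, for every \<open>d\<close>, at
  least as many of its entries as unoccupied places are at most \<open>d\<close>. This is that
  condition at the point with \<open>i\<close> up and \<open>d\<close> down steps.\<close>

definition admissible :: "nat list \<Rightarrow> nat \<Rightarrow> nat \<Rightarrow> bool" where
  "admissible t i d \<longleftrightarrow> card ({1..d} - set t) \<le> i"

lemma admissible_mono:
  assumes "admissible t i d" "i \<le> i'" "d' \<le> d"
  shows "admissible t i' d'"
proof -
  have "card ({1..d'} - set t) \<le> card ({1..d} - set t)"
    using assms(3) by (intro card_mono) auto
  then show ?thesis using assms unfolding admissible_def by linarith
qed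

lemma admissible_diag: "d \<le> i \<Longrightarrow> admissible t i d"
  unfolding admissible_def
  by (rule order_trans[OF card_mono[of "{1..d}"]]) auto

text \<open>Turns a bound on one entry into a count; applied both to \<open>t\<close> and to
  \<open>unoccupied n t\<close>.\<close>

lemma nth_le_iff_less_card:
  fixes xs :: "'a::linorder list"
  assumes "sorted_wrt (<) xs" "i < length xs"
  shows "xs ! i \<le> d \<longleftrightarrow> i < card {x \<in> set xs. x \<le> d}"
proof -
  have less: "xs ! a < xs ! b \<longleftrightarrow> a < b" if "a < length xs" "b < length xs" for a b
    using assms(1) that by (metis linorder_neqE_nat order_less_asym sorted_wrt_iff_nth_less)
  have inj: "inj_on ((!) xs) {..<length xs}"
    using less by (metis inj_onI lessThan_iff less_irrefl linorder_neqE_nat)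
  show ?thesis
  proof
    assume le: "xs ! i \<le> d"
    have "(!) xs ` {..i} \<subseteq> {x \<in> set xs. x \<le> d}"
    proof
      fix x assume "x \<in> (!) xs ` {..i}"
      then obtain a where "a \<le> i" "x = xs ! a" by auto
      then show "x \<in> {x \<in> set xs. x \<le> d}"
        using le less[of a i] assms(2) by (cases "a = i") auto
    qed
    then have "card ((!) xs ` {..i}) \<le> card {x \<in> set xs. x \<le> d}"
      by (intro card_mono) auto
    moreover have "card ((!) xs ` {..i}) = Suc i"
      using assms(2) by (subst card_image) (auto intro: inj_on_subset[OF inj])
    ultimately show "i < card {x \<in> set xs. x \<le> d}" by simp
  next
    assume card: "i < card {x \<in> set xs. x \<le> d}"
    show "xs ! i \<le> d"
    proof (rule ccontr)
      assume gt: "\<not> xs ! i \<le> d"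
      have "{x \<in> set xs. x \<le> d} \<subseteq> (!) xs ` {..<i}"
      proof
        fix x assume "x \<in> {x \<in> set xs. x \<le> d}"
        then obtain a where "a < length xs" "x = xs ! a" "xs ! a \<le> d"
          by (auto simp: in_set_conv_nth)
        then show "x \<in> (!) xs ` {..<i}"
          using gt less[of a i] assms(2) by force
      qed
      then have "card {x \<in> set xs. x \<le> d} \<le> card {..<i}"
        by (meson card_image_le card_mono finite_imageI finite_lessThan order_trans)
      then show False using card by simp
    qed
  qed
qed

text \<open>Among the first \<open>i + Suc j\<close> places, at most \<open>i\<close> are free iff
  at least \<open>Suc j\<close> are taken, which is the test in \<open>passage\<close>.\<close>

lemma admissible_iff_passage:
  assumes "sorted_wrt (<) t" "set t \<subseteq> {1..n}" "i + Suc j \<le> n"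
  shows "admissible t i (i + Suc j) \<longleftrightarrow> j < length t \<and> t ! j \<le> i + Suc j"
proof -
  let ?d = "i + Suc j" and ?S = "{x \<in> set t. x \<le> i + Suc j}"
  have "{1..?d} - set t = {1..?d} - ?S" by auto
  moreover have "?S \<subseteq> {1..?d}" using assms(2) by auto
  ultimately have "card ({1..?d} - set t) = ?d - card ?S"
    by (simp add: card_Diff_subset)
  then have "admissible t i ?d \<longleftrightarrow> j < card ?S"
    unfolding admissible_def by auto
  also have "\<dots> \<longleftrightarrow> j < length t \<and> t ! j \<le> ?d"
  proof (cases "j < length t")
    case True
    then show ?thesis using nth_le_iff_less_card[OF assms(1), of j ?d] by simp
  next
    case False
    have "card ?S \<le> card (set t)" by (intro card_mono) auto
    also have "\<dots> \<le> length t" by (rule card_length)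
    finally show ?thesis using False by simp
  qed
  finally show ?thesis .
qed

lemma length_unoccupied:
  assumes "sorted_wrt (<) t" "set t \<subseteq> {1..n}"
  shows "length (unoccupied n t) = n - length t"
  using assms by (simp add: unoccupied_def card_Diff_subset distinct_card strict_sorted_iff)

text \<open>Admissibility decides whether an up step from this point is allowed: it would put the
  entry \<open>Suc d\<close> at position \<open>i\<close>.\<close>

lemma admissible_iff_unoccupied:
  assumes "sorted_wrt (<) t" "set t \<subseteq> {1..n}" "i < n - length t" "d \<le> n"
  shows "admissible t i d \<longleftrightarrow> Suc d \<le> unoccupied n t ! i"
proof -
  have "{x \<in> set (unoccupied n t). x \<le> d} = {1..d} - set t"
    using assms(4) by (auto simp: unoccupied_def)
  moreover have "sorted_wrt (<) (unoccupied n t)"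
    by (simp add: unoccupied_def)
  ultimately have "unoccupied n t ! i \<le> d \<longleftrightarrow> i < card ({1..d} - set t)"
    using nth_le_iff_less_card[of "unoccupied n t" i d] assms by (simp add: length_unoccupied)
  then show ?thesis unfolding admissible_def by linarith
qed

text \<open>At an admissible point the test in \<open>passage\<close> succeeds, so the two
  correction sums of \<open>paths_rec\<close> cancel except at the origin.\<close>

lemma paths_rec_admissible:
  assumes t: "sorted_wrt (<) t" "set t \<subseteq> {1..n}"
    and adm: "admissible t u d" and "d \<le> n" "u \<le> N"
  shows "paths t N (int u) (int d) =
    paths t N (int u - 1) (int d) + paths t N (int u) (int d - 1)
      + (if u = 0 \<and> d = 0 then 1 else 0)"
proof -
  define X where "X = (\<Sum>j\<le>length t. if int d = int u + int j then passage t j u else 0)"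
  define Y where "Y = (\<Sum>j\<le>length t. if int d = int u + int (Suc j)
         then \<Sum>s\<le>u. passage t j s * catalan (u - s) else 0)"
  have "X = Y + (if u = 0 \<and> d = 0 then 1 else 0)"
  proof (cases "d \<le> u")
    case True
    have "Y = 0" unfolding Y_def by (rule sum.neutral) (use True in auto)
    have "X = (\<Sum>j\<le>length t. if j = 0 then (if u = 0 \<and> d = 0 then 1 else 0) else 0)"
      unfolding X_def by (rule sum.cong) (use True in auto)
    then show ?thesis using \<open>Y = 0\<close> by simp
  next
    case False
    \<comment> \<open>The point has height \<open>-(k + 1)\<close>, so only \<open>j = Suc k\<close>
      contributes to \<open>X\<close> and only \<open>j = k\<close> to \<open>Y\<close>.\<close>
    then obtain k where d: "d = u + Suc k"
      by (metis add_Suc_right less_imp_Suc_add not_le)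
    then have k: "k < length t" "t ! k \<le> u + Suc k"
      using adm admissible_iff_passage[OF t, of u k] \<open>d \<le> n\<close> by auto
    have "X = (\<Sum>j\<le>length t. if j = Suc k then passage t (Suc k) u else 0)"
      unfolding X_def by (rule sum.cong) (use d in auto)
    also have "\<dots> = passage t (Suc k) u" using k by simp
    also have "\<dots> = (\<Sum>s\<le>u. passage t k s * catalan (u - s))" using k by simp
    also have "\<dots> = (\<Sum>j\<le>length t. if j = k
        then \<Sum>s\<le>u. passage t k s * catalan (u - s) else 0)" using k by simp
    also have "\<dots> = Y"
      unfolding Y_def by (rule sum.cong) (use d in auto)
    finally show ?thesis using d by simp
  qed
  then show ?thesis
    using paths_rec[OF \<open>u \<le> N\<close>, of t "int d"] unfolding X_def[symmetric] Y_def[symmetric]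
    by simp
qed

text \<open>At height \<open>-(k + 1)\<close> a nonzero term needs \<open>j > k\<close> and
  \<open>s \<le> u\<close>, so \<open>passage_nonzero_imp\<close> would give the very bound on
  \<open>t ! k\<close> that fails here.\<close>

lemma paths_not_admissible:
  assumes t: "sorted_wrt (<) t" "set t \<subseteq> {1..n}"
    and "\<not> admissible t u d" "d \<le> n"
  shows "paths t N (int u) (int d) = 0"
  unfolding paths_def
proof (intro sum.neutral ballI)
  fix j s
  assume j: "j \<in> {..length t}"
  obtain k where d: "d = u + Suc k"
    using assms(3) admissible_diag by (metis add_Suc_right less_imp_Suc_add not_le)
  then have k: "k < length t \<Longrightarrow> u + Suc k < t ! k"
    using assms(3,4) admissible_iff_passage[OF t, of u k] by auto
  show "passage t j s * ballot (int u - int s) (int d - int s - int j) = 0"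
  proof (rule ccontr)
    assume nz: "\<not> ?thesis"
    then have "\<not> (int d - int s - int j < 0 \<or> int u - int s < int d - int s - int j)"
      using ballot_eq_0 by fastforce
    then have le: "s + j \<le> d" "d \<le> u + j" by linarith+
    then have "k < j" using d by simp
    then have "t ! k \<le> s + Suc k" using nz passage_nonzero_imp[of t j s k] by auto
    moreover have "u + Suc k < t ! k" using \<open>k < j\<close> j k by simp
    ultimately show False using le d \<open>k < j\<close> by linarith
  qed
qed

section \<open>Bounded weakly increasing sequences\<close>

definition bounded_seqs :: "nat list \<Rightarrow> nat \<Rightarrow> nat \<Rightarrow> nat list set" where
  "bounded_seqs u i k =
     {c. length c = i \<and> set c \<subseteq> {1..k} \<and> sorted c \<and> (\<forall>j<i. c ! j \<le> u ! j)}"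

lemma finite_bounded_seqs: "finite (bounded_seqs u i k)"
  by (rule finite_subset[OF _ finite_lists_length_eq[of "{1..k}" i]])
    (auto simp: bounded_seqs_def)

lemma bounded_seqs_0 [simp]: "bounded_seqs u 0 k = {[]}"
  by (auto simp: bounded_seqs_def)

lemma bounded_seqs_Suc_0 [simp]: "bounded_seqs u (Suc i) 0 = {}"
  by (auto simp: bounded_seqs_def)

text \<open>Splits by whether the last, hence largest, entry is \<open>Suc k\<close>: the last step
  of the path is then up, otherwise down.\<close>

lemma bounded_seqs_Suc_Suc:
  "bounded_seqs u (Suc i) (Suc k) = bounded_seqs u (Suc i) k \<union>
     (if Suc k \<le> u ! i then (\<lambda>c. c @ [Suc k]) ` bounded_seqs u i (Suc k) else {})"
  (is "?A = ?B \<union> ?C")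
proof (rule set_eqI)
  fix c :: "nat list"
  show "c \<in> ?A \<longleftrightarrow> c \<in> ?B \<union> ?C"
  proof (cases "length c = Suc i")
    case True
    then obtain b x where c: "c = b @ [x]" "length b = i"
      by (metis length_Suc_conv_rev)
    have snoc: "c \<in> bounded_seqs u (Suc i) q \<longleftrightarrow>
        b \<in> bounded_seqs u i x \<and> 1 \<le> x \<and> x \<le> q \<and> x \<le> u ! i" for q
    proof -
      have "(\<forall>j<Suc i. c ! j \<le> u ! j) \<longleftrightarrow> (\<forall>j<i. b ! j \<le> u ! j) \<and> x \<le> u ! i"
        using c by (auto simp: less_Suc_eq nth_append)
      then show ?thesis
        unfolding bounded_seqs_def using c by (auto simp: sorted_append subset_iff)
    qed
    have "c \<in> ?C \<longleftrightarrow> Suc k \<le> u ! i \<and> x = Suc k \<and> b \<in> bounded_seqs u i x"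
      using c by auto
    then show ?thesis using snoc[of k] snoc[of "Suc k"] by (auto simp: le_Suc_eq)
  qed (auto simp: bounded_seqs_def)
qed

lemma card_bounded_seqs_Suc_Suc:
  "card (bounded_seqs u (Suc i) (Suc k)) = card (bounded_seqs u (Suc i) k) +
     (if Suc k \<le> u ! i then card (bounded_seqs u i (Suc k)) else 0)"
proof -
  have "bounded_seqs u (Suc i) k \<inter> (\<lambda>c. c @ [Suc k]) ` bounded_seqs u i (Suc k) = {}"
    by (auto simp: bounded_seqs_def)
  then show ?thesis
    by (simp add: bounded_seqs_Suc_Suc card_Un_disjoint finite_bounded_seqs card_image inj_on_def)
qed

text \<open>Both sides obey the last-step recurrence on admissible points. The bound is
  \<open>Suc d\<close> because up steps after the \<open>d\<close>-th down step are entries equal to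
  \<open>d + 1\<close>.\<close>

lemma card_bounded_seqs_eq_paths:
  assumes t: "sorted_wrt (<) t" "set t \<subseteq> {1..n}"
    and "N = n - length t"
  shows "i \<le> N \<Longrightarrow> d \<le> n \<Longrightarrow> admissible t i d \<Longrightarrow>
    real (card (bounded_seqs (unoccupied n t) i (Suc d))) = paths t N (int i) (int d)"
proof (induction "i + d" arbitrary: i d rule: less_induct)
  case less
  let ?f = "\<lambda>i d. real (card (bounded_seqs (unoccupied n t) i d))"
  note rec = paths_rec_admissible[OF t less.prems(3,2,1)]
  have down: "?f i d = paths t N (int i) (int d - 1)" if "i > 0 \<or> d > 0"
  proof (cases d)
    case 0
    then show ?thesis using that by (cases i) (auto simp: paths_eq_0)
  next
    case (Suc e)
    then have "admissible t i e" using less.prems(3) admissible_mono by simp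
    then show ?thesis using less Suc by simp
  qed
  show ?case
  proof (cases i)
    case 0
    then show ?thesis using rec down by (cases d) (auto simp: paths_eq_0)
  next
    case (Suc k)
    \<comment> \<open>Removing an up step may leave the admissible region; then the entry is
      forbidden and \<open>paths\<close> vanishes as well.\<close>
    have "(if Suc d \<le> unoccupied n t ! k then ?f k (Suc d) else 0) = paths t N (int k) (int d)"
    proof (cases "admissible t k d")
      case True
      then show ?thesis
        using less Suc assms admissible_iff_unoccupied[OF t, of k d] by simp
    next
      case False
      then show ?thesis
        using less.prems Suc assms admissible_iff_unoccupied[OF t, of k d]
          paths_not_admissible[OF t False] by simp
    qed
    then show ?thesis
      using rec down Suc
      by (simp add: card_bounded_seqs_Suc_Suc if_distrib[of real] del: if_split cong: if_cong)
  qed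
qed

section \<open>Sums over semilength sequences\<close>

definition semilengths :: "nat list \<Rightarrow> nat \<Rightarrow> nat \<Rightarrow> nat list set" where
  "semilengths t j s =
     {l. length l = j \<and> (\<forall>i<j. t ! i \<le> sum_list (take (Suc i) l) + Suc i) \<and> sum_list l = s}"

lemma finite_lists_sum: "finite {l :: nat list. length l = j \<and> sum_list l = s}"
  by (rule finite_subset[OF _ finite_lists_length_eq[of "{..s}" j]])
    (auto intro: member_le_sum_list)

lemma finite_semilengths: "finite (semilengths t j s)"
  by (rule finite_subset[OF _ finite_lists_sum[of j s]]) (auto simp: semilengths_def)

lemma sum_semilengths_snoc:
  fixes f :: "nat \<Rightarrow> 'a::comm_semiring_1"
  shows "(\<Sum>l\<in>(\<Union>r\<le>s. (\<lambda>l. l @ [s - r]) ` semilengths t j r). prod_list (map f l)) =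
    (\<Sum>r\<le>s. (\<Sum>l\<in>semilengths t j r. prod_list (map f l)) * f (s - r))"
proof -
  have "(\<Sum>l\<in>(\<Union>r\<le>s. (\<lambda>l. l @ [s - r]) ` semilengths t j r). prod_list (map f l)) =
      (\<Sum>r\<le>s. \<Sum>l\<in>(\<lambda>l. l @ [s - r]) ` semilengths t j r. prod_list (map f l))"
    using finite_semilengths by (intro sum.UNION_disjoint ballI finite_imageI) (blast |  auto simp: semilengths_def)+
  also have "\<dots> = (\<Sum>r\<le>s. (\<Sum>l\<in>semilengths t j r. prod_list (map f l)) * f (s - r))"
    by (intro sum.cong refl) (simp add: sum.reindex inj_on_def sum_distrib_right)
  finally show ?thesis .
qed

text \<open>Stated for arbitrary \<open>X\<close> to cover both
  \<open>semilengths t (Suc j) s\<close> and \<open>L n t\<close>: with the total fixed, the last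
  entry is determined and adds no condition that depends on the other entries.\<close>

lemma snoc_decomposition:
  assumes "\<And>l. l \<in> X \<Longrightarrow> length l = Suc j \<and> sum_list l = s"
    and "\<And>b x. length b = j \<Longrightarrow> sum_list b + x = s \<Longrightarrow>
      b @ [x] \<in> X \<longleftrightarrow> b \<in> semilengths t j (sum_list b)"
  shows "X = (\<Union>r\<le>s. (\<lambda>l. l @ [s - r]) ` semilengths t j r)"
proof (intro equalityI subsetI)
  fix l assume l: "l \<in> X"
  then obtain b x where b: "l = b @ [x]" "length b = j"
    using assms(1) by (metis length_Suc_conv_rev)
  then have "sum_list b + x = s" using assms(1)[OF l] by simp
  moreover have "b \<in> semilengths t j (sum_list b)"
    using assms(2) b l calculation by simp
  ultimately show "l \<in> (\<Union>r\<le>s. (\<lambda>l. l @ [s - r]) ` semilengths t j r)"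
    using b by (intro UN_I[of "sum_list b"]) auto
next
  fix l assume "l \<in> (\<Union>r\<le>s. (\<lambda>l. l @ [s - r]) ` semilengths t j r)"
  then obtain r b where b: "r \<le> s" "b \<in> semilengths t j r" "l = b @ [s - r]" by auto
  then have "length b = j" "sum_list b = r" by (auto simp: semilengths_def)
  then show "l \<in> X" using assms(2)[of b "s - r"] b by simp
qed

lemma passage_eq_sum:
  "passage t j s = (\<Sum>l\<in>semilengths t j s. prod_list (map catalan l))"
proof (induction j arbitrary: s)
  case 0
  have "semilengths t 0 s = (if s = 0 then {[]} else {})"
    by (auto simp: semilengths_def)
  then show ?case by simp
next
  case (Suc j)
  show ?case
  \<comment> \<open>The last bound involves the whole sum, so it holds for all lists of sum
    \<open>s\<close> or for none.\<close>
  proof (cases "t ! j \<le> s + Suc j")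
    case True
    have "semilengths t (Suc j) s = (\<Union>r\<le>s. (\<lambda>l. l @ [s - r]) ` semilengths t j r)"
      by (rule snoc_decomposition) (use True in \<open>auto simp: semilengths_def less_Suc_eq\<close>)
    then show ?thesis
      using True by (simp add: sum_semilengths_snoc Suc)
  next
    case False
    then have "semilengths t (Suc j) s = {}"
      by (force simp: semilengths_def)
    then show ?thesis using False by simp
  qed
qed

text \<open>The last Dyck block ends with the path and not at a first passage, so the right side is
  the recursion of \<open>passage\<close> without its test.\<close>

lemma sum_L:
  assumes "length t \<le> n"
  shows "(\<Sum>l\<in>L n t. prod_list (map catalan l)) =
    (\<Sum>s\<le>n - length t. passage t (length t) s * catalan (n - length t - s))"
proof -
  have cond: "(\<forall>j\<in>{1..length t}. int (t ! (j - 1)) - int j \<le> int (sum_list (take j l))) \<longleftrightarrow>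
      (\<forall>i<length t. t ! i \<le> sum_list (take (Suc i) l) + Suc i)" (is "?l \<longleftrightarrow> ?r") for l
  proof
    assume ?l
    show ?r
    proof (intro allI impI)
      fix i assume "i < length t"
      then show "t ! i \<le> sum_list (take (Suc i) l) + Suc i"
        using bspec[OF \<open>?l\<close>, of "Suc i"] by simp
    qed
  next
    assume r: ?r
    show ?l
    proof
      fix j assume "j \<in> {1..length t}"
      then show "int (t ! (j - 1)) - int j \<le> int (sum_list (take j l))"
        using spec[OF r, of "j - 1"] by (cases j) auto
    qed
  qed
  have L: "L n t = {l. length l = length t + 1 \<and>
      (\<forall>i<length t. t ! i \<le> sum_list (take (Suc i) l) + Suc i) \<and> sum_list l = n - length t}"
    unfolding L_def cond using assms by auto
  have "L n t = (\<Union>r\<le>n - length t.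
      (\<lambda>l. l @ [n - length t - r]) ` semilengths t (length t) r)"
    by (rule snoc_decomposition) (auto simp: L semilengths_def)
  then show ?thesis
    by (simp only: sum_semilengths_snoc passage_eq_sum)
qed

section \<open>Evaluation at the end point of the path\<close>

theorem theorem1p3:
  fixes n m :: nat and t :: "nat list"
  assumes "n \<ge> 1"
    and "length t = m"
    and "sorted_wrt (<) t"
    and "set t \<subseteq> {1..n}"
  shows "real (card (IPC n t)) =
    (\<Sum>l\<in>L n t. \<Prod>i=1..m+1.
       1 / (real (l ! (i - 1)) + 1) * real ((2 * (l ! (i - 1))) choose (l ! (i - 1))))"
proof -
  note t = assms(3,4)
  define N where "N = n - m"
  have "m = card (set t)" using assms by (simp add: distinct_card strict_sorted_iff)
  also have "\<dots> \<le> card {1..n}" using assms by (intro card_mono) auto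
  finally have mn: "m \<le> n" by simp
  have "card ({1..n} - set t) = N"
    using length_unoccupied[OF t] assms(2) by (simp add: unoccupied_def N_def)
  then have adm: "admissible t N n" by (simp add: admissible_def)
  have "IPC n t = bounded_seqs (unoccupied n t) N (Suc (n - 1))"
    using assms by (simp add: IPC_def bounded_seqs_def N_def)
  then have "real (card (IPC n t)) = paths t N (int N) (int (n - 1))"
    using card_bounded_seqs_eq_paths[OF t, of N N "n - 1"] assms(2)
      admissible_mono[OF adm, of N "n - 1"] by (simp add: N_def)
  \<comment> \<open>The final down step is forced: the other predecessor, with \<open>N - 1\<close>
    up and \<open>n\<close> down steps, lies below height \<open>-m\<close>, where
    \<open>paths\<close> is 0.\<close>
  also have "\<dots> = paths t N (int N) (int n)"
    using paths_rec_admissible[OF t adm, of N] assms mn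
    by (simp add: paths_eq_0 N_def of_nat_diff)
  \<comment> \<open>The end height is \<open>-m\<close>, so for \<open>j < m\<close> the remaining
    path would end below its minimum; for \<open>j = m\<close> it is a Dyck path.\<close>
  also have "\<dots> = (\<Sum>j\<le>m. if j = m then \<Sum>s\<le>N. passage t m s * catalan (N - s) else 0)"
    unfolding paths_def \<open>length t = m\<close>
  proof (rule sum.cong)
    fix j assume j: "j \<in> {..m}"
    show "(\<Sum>s\<le>N. passage t j s * ballot (int N - int s) (int n - int s - int j)) =
        (if j = m then \<Sum>s\<le>N. passage t m s * catalan (N - s) else 0)"
    proof (cases "j = m")
      case True
      have "ballot (int N - int s) (int n - int s - int m) = catalan (N - s)" if "s \<le> N" for s
      proof -
        have "int N - int s = int (N - s)" "int n - int s - int m = int (N - s)"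
          using that mn by (auto simp: N_def)
        then show ?thesis by (simp only: ballot_diag)
      qed
      then show ?thesis using True by simp
    next
      case False
      then have "ballot (int N - int s) (int n - int s - int j) = 0" for s
        using j mn by (intro ballot_eq_0) (auto simp: N_def)
      then show ?thesis using False by simp
    qed
  qed simp
  also have "\<dots> = (\<Sum>l\<in>L n t. prod_list (map catalan l))"
    using sum_L[of t n] mn assms(2) by (simp add: N_def)
  also have "\<dots> = (\<Sum>l\<in>L n t. \<Prod>i=1..m+1.
       1 / (real (l ! (i - 1)) + 1) * real ((2 * (l ! (i - 1))) choose (l ! (i - 1))))"
  proof (rule sum.cong)
    fix l assume "l \<in> L n t"
    then have len: "length l = Suc m" using assms(2) by (simp add: L_def)
    have "prod_list (map catalan l) = (\<Prod>i<Suc m. catalan (l ! i))"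
      using len by (simp add: prod.list_conv_set_nth atLeast0LessThan)
    also have "\<dots> = (\<Prod>i=1..m+1. catalan (l ! (i - 1)))"
      by (rule prod.reindex_bij_witness[of _ "\<lambda>i. i - 1" Suc]) auto
    finally show "prod_list (map catalan l) = (\<Prod>i=1..m+1.
       1 / (real (l ! (i - 1)) + 1) * real ((2 * (l ! (i - 1))) choose (l ! (i - 1))))"
      by (simp only: catalan_def)
  qed simp
  finally show ?thesis .
qed

end
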